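(* Let $ABCD$ be an isosceles tetrahedron in Euclidean 3-space with circumsphere $\Omega$, and let $X\in\Omega$ be a point with $X\notin\{A,B,C,D\}$. Then the isogonal conjugate of $X$ with respect to $ABCD$ exists and lies on $\Omega$.
   Context: A (non-degenerate) tetrahedron $ABCD$ is called isosceles if its opposite edges are equal: $AB=CD$, $BC=AD$, $AC=BD$. Isogonal conjugation: for the dihedral angle of the tetrahedron at an edge with edgeline $e$ and a point $P$, let $Pe$ be the plane through $P$ and $e$; its isogonal plane is the reflection of $Pe$ in the bisector plane of the dihedral angle. If $P$ lies on $e$, then the plane $Pe$, as well as its isogonal, may be taken to be any plane through $e$ (so the condition at $e$ is then vacuous). The isogonal conjugate of $P$ with respect to the tetrahedron is the point $Q$ such that for each of the six dihedral angles $P$ and $Q$ lie in mutually isogonal planes through the corresponding edgeline (the condition at an edgeline $e$ being vacuous if $P$ or $Q$ lies on $e$). *)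

theory Defs
  imports "HOL-Analysis.Analysis"
begin

definition isosceles_tetrahedron :: "real^3 \<Rightarrow> real^3 \<Rightarrow> real^3 \<Rightarrow> real^3 \<Rightarrow> bool" where
  "isosceles_tetrahedron A B C D \<longleftrightarrow>
     \<not> coplanar {A, B, C, D} \<and>
     dist A B = dist C D \<and> dist B C = dist A D \<and> dist A C = dist B D"

definition is_circumsphere :: "(real^3) set \<Rightarrow> real^3 \<Rightarrow> real^3 \<Rightarrow> real^3 \<Rightarrow> real^3 \<Rightarrow> bool" where
  "is_circumsphere \<Omega> A B C D \<longleftrightarrow> (\<exists>c r. \<Omega> = sphere c r) \<and> {A, B, C, D} \<subseteq> \<Omega>"

text \<open>Below, an edge of a tetrahedron is given by its endpoints \<open>E\<close>, \<open>F\<close>; the other two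
  vertices are \<open>R\<close> and \<open>S\<close>, so the dihedral angle at this edge is formed by the half-planes
  bounded by the line \<open>EF\<close> through \<open>R\<close> and through \<open>S\<close>.\<close>

abbreviation edgeline :: "real^3 \<Rightarrow> real^3 \<Rightarrow> (real^3) set" where
  "edgeline E F \<equiv> affine hull {E, F}"

text \<open>The unit vector orthogonal to the line \<open>EF\<close> pointing into its half-plane through \<open>R\<close>:
  \<open>closest_point\<close> gives the foot of the perpendicular from \<open>R\<close>, and \<open>sgn\<close> normalizes.\<close>

definition face_direction :: "real^3 \<Rightarrow> real^3 \<Rightarrow> real^3 \<Rightarrow> real^3" where
  "face_direction E F R = sgn (R - closest_point (edgeline E F) R)"

text \<open>The (internal) bisector plane: the sum of the two unit vectors bisects the plane angle
  that measures the dihedral angle.\<close>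

definition bisector_plane :: "real^3 \<Rightarrow> real^3 \<Rightarrow> real^3 \<Rightarrow> real^3 \<Rightarrow> (real^3) set" where
  "bisector_plane E F R S = affine hull {E, F, E + (face_direction E F R + face_direction E F S)}"

text \<open>Orthogonal reflection in an affine subspace \<open>H\<close>.\<close>

definition reflect_in :: "(real^3) set \<Rightarrow> real^3 \<Rightarrow> real^3" where
  "reflect_in H x = 2 *\<^sub>R closest_point H x - x"

definition isogonal_plane ::
  "real^3 \<Rightarrow> real^3 \<Rightarrow> real^3 \<Rightarrow> real^3 \<Rightarrow> (real^3) set \<Rightarrow> (real^3) set" where
  "isogonal_plane E F R S \<pi> = reflect_in (bisector_plane E F R S) ` \<pi>"

text \<open>When \<open>P\<close> is not on the edgeline, \<open>affine hull {E, F, P}\<close> is the plane through \<open>P\<close> and the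
  edge.\<close>

definition isogonal_at ::
  "real^3 \<Rightarrow> real^3 \<Rightarrow> real^3 \<Rightarrow> real^3 \<Rightarrow> real^3 \<Rightarrow> real^3 \<Rightarrow> bool" where
  "isogonal_at E F R S P Q \<longleftrightarrow>
     P \<in> edgeline E F \<or> Q \<in> edgeline E F \<or>
     Q \<in> isogonal_plane E F R S (affine hull {E, F, P})"

text \<open>\<open>Q\<close> is an isogonal conjugate of \<open>P\<close>; that it is the only one is not part of this
  predicate.\<close>

definition isogonal_conjugate ::
  "real^3 \<Rightarrow> real^3 \<Rightarrow> real^3 \<Rightarrow> real^3 \<Rightarrow> real^3 \<Rightarrow> real^3 \<Rightarrow> bool" where
  "isogonal_conjugate A B C D P Q \<longleftrightarrow>
     isogonal_at A B C D P Q \<and> isogonal_at A C B D P Q \<and> isogonal_at A D B C P Q \<and>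
     isogonal_at B C A D P Q \<and> isogonal_at B D A C P Q \<and> isogonal_at C D A B P Q"

end

theory Submission imports Defs begin

text \<open>
  In barycentric coordinates the theorem is a statement about coordinatewise inversion. The faces of
  an isosceles tetrahedron are congruent, so the distances of a point to the four face planes are
  proportional to its barycentric coordinates, and the isogonality condition at the edge \<open>EF\<close>
  between points with coordinates \<open>p\<close> and \<open>q\<close> becomes \<open>p\<^sub>R q\<^sub>R = p\<^sub>S q\<^sub>S\<close>
  (lemma \<open>isogonal_at_iff_barycentric\<close>). This also covers the points of the edgeline, where both
  sides vanish. Hence \<open>Q\<close> is conjugate to \<open>X\<close> exactly when the four products of corresponding
  coordinates agree.

  Let \<open>l\<close>, \<open>m\<close>, \<open>n\<close> be the squared lengths of the three pairs of opposite edges. The circumsphere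
  is the zero set of \<open>l(xy + zw) + m(yz + xw) + n(xz + yw)\<close> (lemma \<open>norm_barycentric_circumcentre\<close>).
  Replacing all coordinates by their inverses divides this form by \<open>xyzw\<close>, so the conjugate, with
  coordinates proportional to \<open>1/x, 1/y, 1/z, 1/w\<close>, again lies on the circumsphere.

  This breaks down only if some coordinate vanishes or the inverses add up to \<open>0\<close>. The latter is
  impossible: on coordinates with sum \<open>0\<close>, which represent vectors, the form is minus the squared
  length, so the inverses would represent a vector of length \<open>0\<close>, although none of them is \<open>0\<close>.
  If exactly one coordinate vanishes, the conjugate is the opposite vertex. Two vanishing
  coordinates put \<open>X\<close> on an edgeline, which meets the sphere only in vertices.
\<close>

section \<open>Affine coordinates with respect to a tetrahedron\<close>

lemma affine_hull_3_point_directions: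
  fixes E F G P :: "'a::real_vector"
  shows "P \<in> affine hull {E, F, G} \<longleftrightarrow> (\<exists>s t. P = E + s *\<^sub>R (F - E) + t *\<^sub>R (G - E))"
proof
  assume "P \<in> affine hull {E, F, G}"
  then obtain a b c where abc: "a + b + c = 1" "P = a *\<^sub>R E + b *\<^sub>R F + c *\<^sub>R G"
    unfolding affine_hull_3 by blast
  then have "a = 1 - b - c" by simp
  with abc(2) have "P = E + b *\<^sub>R (F - E) + c *\<^sub>R (G - E)" by (simp add: algebra_simps)
  then show "\<exists>s t. P = E + s *\<^sub>R (F - E) + t *\<^sub>R (G - E)" by blast
next
  assume "\<exists>s t. P = E + s *\<^sub>R (F - E) + t *\<^sub>R (G - E)"
  then obtain s t where "P = E + s *\<^sub>R (F - E) + t *\<^sub>R (G - E)" by blast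
  then have "P = (1 - s - t) *\<^sub>R E + s *\<^sub>R F + t *\<^sub>R G" by (simp add: algebra_simps)
  moreover have "(1 - s - t) + s + t = 1" by simp
  ultimately show "P \<in> affine hull {E, F, G}" unfolding affine_hull_3 by blast
qed

lemma edgeline_iff: "P \<in> edgeline E F \<longleftrightarrow> (\<exists>s. P = E + s *\<^sub>R (F - E))"
  using affine_hull_3_point_directions[of P E F E] by (simp add: insert_commute)

lemma affine_independent_if_not_coplanar:
  fixes A B C D :: "real^3"
  assumes "\<not> coplanar {A, B, C, D}"
  shows "\<not> affine_dependent {A, B, C, D}" and "card {A, B, C, D} = 4"
proof -
  have no3: "\<not> {A, B, C, D} \<subseteq> affine hull {U, V, W}" for U V W
    using assms unfolding coplanar_def by blast
  have inner: "{U, V, W} \<subseteq> affine hull {U, V, W}" for U V W :: "real^3"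
    by (rule hull_subset)
  have "A \<notin> affine hull {B, C, D}" "B \<notin> affine hull {A, C, D}"
    "C \<notin> affine hull {A, B, D}" "D \<notin> affine hull {A, B, C}"
    using no3[of B C D] no3[of A C D] no3[of A B D] no3[of A B C]
      inner[of B C D] inner[of A C D] inner[of A B D] inner[of A B C] by auto
  moreover from this have distinct: "A \<noteq> B" "A \<noteq> C" "A \<noteq> D" "B \<noteq> C" "B \<noteq> D" "C \<noteq> D"
    by (auto intro: hull_inc)
  moreover have "{A, B, C, D} - {A} = {B, C, D}" "{A, B, C, D} - {B} = {A, C, D}"
    "{A, B, C, D} - {C} = {A, B, D}" "{A, B, C, D} - {D} = {A, B, C}"
    using distinct by auto
  ultimately show "\<not> affine_dependent {A, B, C, D}"
    unfolding affine_dependent_def by auto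
  show "card {A, B, C, D} = 4"
    using distinct by simp
qed

lemma barycentric_coordinates_exist:
  fixes A B C D P :: "real^3"
  assumes "\<not> coplanar {A, B, C, D}"
  obtains x y z w where "x + y + z + w = 1"
    and "P = x *\<^sub>R A + y *\<^sub>R B + z *\<^sub>R C + w *\<^sub>R D"
proof -
  note ind = affine_independent_if_not_coplanar[OF assms]
  have "affine hull {A, B, C, D} = UNIV"
    using ind by (intro affine_independent_span_eq) auto
  then have "P \<in> affine hull {A, B, C, D}" by simp
  then obtain u where u: "sum u {A, B, C, D} = 1" "(\<Sum>v\<in>{A, B, C, D}. u v *\<^sub>R v) = P"
    by (subst (asm) affine_hull_finite) auto
  have "A \<noteq> B" "A \<noteq> C" "A \<noteq> D" "B \<noteq> C" "B \<noteq> D" "C \<noteq> D"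
    using ind(2) by (auto simp: card_insert_if split: if_splits)
  then show thesis
    using u by (intro that[of "u A" "u B" "u C" "u D"]) (simp_all add: add.assoc)
qed

lemma edge_vectors_independent:
  fixes E F R S :: "real^3"
  assumes "\<not> coplanar {E, F, R, S}"
    and comb: "x *\<^sub>R (F - E) + y *\<^sub>R (R - E) + z *\<^sub>R (S - E) = 0"
  shows "x = 0 \<and> y = 0 \<and> z = 0"
proof (rule ccontr)
  assume nontrivial: "\<not> ?thesis"
  note ind = affine_independent_if_not_coplanar[OF assms(1)]
  have distinct: "E \<noteq> F" "E \<noteq> R" "E \<noteq> S" "F \<noteq> R" "F \<noteq> S" "R \<noteq> S"
    using ind(2) by (auto simp: card_insert_if split: if_splits)
  let ?u = "\<lambda>p. if p = F then x else if p = R then y else if p = S then z else - (x + y + z)"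
  have "sum ?u {E, F, R, S} = 0" using distinct by simp
  moreover have "\<exists>v\<in>{E, F, R, S}. ?u v \<noteq> 0" using distinct nontrivial by auto
  moreover have "(\<Sum>v\<in>{E, F, R, S}. ?u v *\<^sub>R v) = 0"
    using distinct comb by (simp add: algebra_simps)
  ultimately have "affine_dependent {E, F, R, S}"
    by (subst affine_dependent_explicit_finite) blast+
  then show False using ind(1) by simp
qed

section \<open>Isogonality at an edge\<close>

lemma closest_point_affine_eqI:
  fixes x y :: "'a::euclidean_space"
  assumes "affine S" "y \<in> S" and orth: "\<And>z. z \<in> S \<Longrightarrow> (x - y) \<bullet> (z - y) = 0"
  shows "closest_point S x = y"
proof -
  have "dist x y \<le> dist x z" if "z \<in> S" for z
  proof -
    have "(dist x z)\<^sup>2 = (dist x y)\<^sup>2 + (dist y z)\<^sup>2"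
      using orth[OF that] unfolding dist_norm power2_norm_eq_inner
      by (simp add: inner_simps inner_commute algebra_simps)
    then have "(dist x y)\<^sup>2 \<le> (dist x z)\<^sup>2" by simp
    then show ?thesis by (rule power2_le_imp_le) simp
  qed
  with assms(1,2) show ?thesis
    by (metis affine_imp_convex affine_closed closest_point_unique)
qed

lemma closest_point_edgeline:
  assumes "E \<noteq> F"
  shows "closest_point (edgeline E F) R
    = E + (((R - E) \<bullet> (F - E)) / ((F - E) \<bullet> (F - E))) *\<^sub>R (F - E)" (is "_ = E + ?t *\<^sub>R ?d")
proof (rule closest_point_affine_eqI)
  show "affine (edgeline E F)" by simp
  show "E + ?t *\<^sub>R ?d \<in> edgeline E F" unfolding edgeline_iff by blast
next
  fix Z assume "Z \<in> edgeline E F"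
  then obtain b where "Z = E + b *\<^sub>R ?d" unfolding edgeline_iff by blast
  then have "Z - (E + ?t *\<^sub>R ?d) = (b - ?t) *\<^sub>R ?d" by (simp add: algebra_simps)
  moreover have "(R - (E + ?t *\<^sub>R ?d)) \<bullet> ?d = (R - E) \<bullet> ?d - ?t * (?d \<bullet> ?d)"
    unfolding diff_diff_eq[symmetric] inner_diff_left[of "R - E"] inner_scaleR_left ..
  moreover have "\<dots> = 0" using assms by simp
  ultimately show "(R - (E + ?t *\<^sub>R ?d)) \<bullet> (Z - (E + ?t *\<^sub>R ?d)) = 0"
    by simp
qed

text \<open>The faces \<open>EFR\<close> and \<open>FES\<close> are congruent triangles, so their altitudes \<open>h\<close> onto the common
  edge are equal. Thus \<open>p\<^sub>R h\<close> and \<open>p\<^sub>S h\<close> are the coordinates of a point with respect to the two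
  face directions.\<close>

lemma face_directions_equal_altitudes:
  fixes E F R S :: "real^3"
  assumes ncop: "\<not> coplanar {E, F, R, S}"
    and dist: "dist E R = dist F S" "dist F R = dist E S"
  obtains h \<rho> \<sigma> where "h > 0"
    and "R - E = \<rho> *\<^sub>R (F - E) + h *\<^sub>R face_direction E F R"
    and "S - E = \<sigma> *\<^sub>R (F - E) + h *\<^sub>R face_direction E F S"
    and "face_direction E F R \<bullet> face_direction E F R = 1"
    and "face_direction E F S \<bullet> face_direction E F S = 1"
    and "face_direction E F R \<bullet> (F - E) = 0"
    and "face_direction E F S \<bullet> (F - E) = 0"
proof -
  define d where "d = F - E"
  define r where "r = R - E"
  define s where "s = S - E"
  have indep: "x = 0 \<and> y = 0 \<and> z = 0" if "x *\<^sub>R d + y *\<^sub>R r + z *\<^sub>R s = 0" for x y z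
    using edge_vectors_independent[OF ncop] that unfolding d_def r_def s_def by blast
  have "d \<noteq> 0" using indep[of 1 0 0] by auto
  then have dd: "d \<bullet> d > 0" and "E \<noteq> F" by (auto simp: d_def)
  define \<rho> where "\<rho> = (r \<bullet> d) / (d \<bullet> d)"
  define \<sigma> where "\<sigma> = (s \<bullet> d) / (d \<bullet> d)"
  define a where "a = r - \<rho> *\<^sub>R d"
  define b where "b = s - \<sigma> *\<^sub>R d"
  have fR: "face_direction E F R = sgn a" and fS: "face_direction E F S = sgn b"
    unfolding face_direction_def closest_point_edgeline[OF \<open>E \<noteq> F\<close>] a_def b_def \<rho>_def \<sigma>_def
      r_def s_def d_def by (simp_all add: algebra_simps)
  have "a \<noteq> 0" using indep[of "- \<rho>" 1 0] by (auto simp: a_def)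
  have "b \<noteq> 0" using indep[of "- \<sigma>" 0 1] by (auto simp: b_def)
  have \<rho>: "r \<bullet> d = \<rho> * (d \<bullet> d)" and \<sigma>: "s \<bullet> d = \<sigma> * (d \<bullet> d)"
    using dd by (simp_all add: \<rho>_def \<sigma>_def)
  have ad: "a \<bullet> d = 0" and bd: "b \<bullet> d = 0"
    using \<rho> \<sigma> by (simp_all add: a_def b_def inner_simps)
  have "r \<bullet> r = (s - d) \<bullet> (s - d)" "(r - d) \<bullet> (r - d) = s \<bullet> s"
    using dist unfolding r_def s_def d_def dist_norm norm_eq
    by (simp_all add: inner_diff_left inner_diff_right inner_commute)
  then have rr: "r \<bullet> r = s \<bullet> s - 2 * (s \<bullet> d) + d \<bullet> d" and ss: "s \<bullet> s = r \<bullet> r - 2 * (r \<bullet> d) + d \<bullet> d"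
    by (simp_all add: inner_diff_left inner_diff_right inner_commute)
  \<comment> \<open>The congruence exchanges \<open>E\<close> and \<open>F\<close>, hence the feet of the altitudes are symmetric with
    respect to the midpoint of \<open>EF\<close>.\<close>
  have "(\<rho> + \<sigma>) * (d \<bullet> d) = 1 * (d \<bullet> d)"
    using rr ss \<rho> \<sigma> by (simp add: algebra_simps)
  then have "\<sigma> = 1 - \<rho>" using dd by simp
  have "a \<bullet> a = r \<bullet> r - 2 * \<rho> * (r \<bullet> d) + \<rho>\<^sup>2 * (d \<bullet> d)"
    "b \<bullet> b = s \<bullet> s - 2 * \<sigma> * (s \<bullet> d) + \<sigma>\<^sup>2 * (d \<bullet> d)"
    unfolding a_def b_def by (simp_all add: inner_simps inner_commute power2_eq_square algebra_simps)
  then have "a \<bullet> a = b \<bullet> b"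
    unfolding ss \<rho> \<sigma> \<open>\<sigma> = 1 - \<rho>\<close> by (simp add: power2_eq_square algebra_simps)
  then have "norm a = norm b" by (simp add: norm_eq)
  show thesis
  proof
    show "norm a > 0" using \<open>a \<noteq> 0\<close> by simp
    show "R - E = \<rho> *\<^sub>R (F - E) + norm a *\<^sub>R face_direction E F R"
      unfolding fR r_def[symmetric] d_def[symmetric]
      using \<open>a \<noteq> 0\<close> by (simp add: sgn_div_norm a_def)
    show "S - E = \<sigma> *\<^sub>R (F - E) + norm a *\<^sub>R face_direction E F S"
      unfolding fS s_def[symmetric] d_def[symmetric] \<open>norm a = norm b\<close>
      using \<open>b \<noteq> 0\<close> by (simp add: sgn_div_norm b_def)
    show "face_direction E F R \<bullet> face_direction E F R = 1"
      unfolding fR using \<open>a \<noteq> 0\<close> by (simp add: norm_eq_1[symmetric] norm_sgn)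
    show "face_direction E F S \<bullet> face_direction E F S = 1"
      unfolding fS using \<open>b \<noteq> 0\<close> by (simp add: norm_eq_1[symmetric] norm_sgn)
    show "face_direction E F R \<bullet> (F - E) = 0"
      unfolding fR d_def[symmetric] using ad by (simp add: sgn_div_norm)
    show "face_direction E F S \<bullet> (F - E) = 0"
      unfolding fS d_def[symmetric] using bd by (simp add: sgn_div_norm)
  qed
qed

text \<open>The plane spanned by \<open>F - E\<close> and \<open>u + v\<close> is orthogonal to \<open>u - v\<close>, since \<open>u\<close> and \<open>v\<close> have equal
  length; so the reflection exchanges \<open>u\<close> and \<open>v\<close>.\<close>

lemma reflect_in_bisector_swaps:
  fixes E F u v :: "real^3"
  assumes "u \<bullet> u = 1" "v \<bullet> v = 1" "u \<bullet> (F - E) = 0" "v \<bullet> (F - E) = 0"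
  shows "reflect_in (affine hull {E, F, E + (u + v)}) (E + t *\<^sub>R (F - E) + \<alpha> *\<^sub>R u + \<beta> *\<^sub>R v)
    = E + t *\<^sub>R (F - E) + \<beta> *\<^sub>R u + \<alpha> *\<^sub>R v"
proof -
  let ?P = "E + t *\<^sub>R (F - E) + \<alpha> *\<^sub>R u + \<beta> *\<^sub>R v"
  let ?M = "E + t *\<^sub>R (F - E) + ((\<alpha> + \<beta>) / 2) *\<^sub>R (u + v)"
  have halves: "(\<alpha> + \<beta>) / 2 + (\<alpha> - \<beta>) / 2 = \<alpha>" "(\<alpha> + \<beta>) / 2 - (\<alpha> - \<beta>) / 2 = \<beta>"
    by (simp_all add: field_simps)
  have "E + t *\<^sub>R (F - E) + (m + e) *\<^sub>R u + (m - e) *\<^sub>R v - (E + t *\<^sub>R (F - E) + m *\<^sub>R (u + v))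
      = e *\<^sub>R (u - v)" for m e
    by (simp add: algebra_simps)
  from this[of "(\<alpha> + \<beta>) / 2" "(\<alpha> - \<beta>) / 2"]
  have PM: "?P - ?M = ((\<alpha> - \<beta>) / 2) *\<^sub>R (u - v)"
    unfolding halves .
  have "closest_point (affine hull {E, F, E + (u + v)}) ?P = ?M"
  proof (rule closest_point_affine_eqI)
    show "?M \<in> affine hull {E, F, E + (u + v)}"
      unfolding affine_hull_3_point_directions by (metis add_diff_cancel_left')
    fix Z assume "Z \<in> affine hull {E, F, E + (u + v)}"
    then obtain s' t' where Z: "Z = E + s' *\<^sub>R (F - E) + t' *\<^sub>R (u + v)"
      unfolding affine_hull_3_point_directions by auto
    have "Z - ?M = (s' - t) *\<^sub>R (F - E) + (t' - (\<alpha> + \<beta>) / 2) *\<^sub>R (u + v)"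
      unfolding Z scaleR_diff_left by (simp add: algebra_simps)
    moreover have "(u - v) \<bullet> (F - E) = 0" using assms(3,4) by (simp add: inner_diff_left)
    moreover have "(u - v) \<bullet> (u + v) = 0"
      using assms(1,2) by (simp add: inner_simps inner_commute)
    ultimately show "(?P - ?M) \<bullet> (Z - ?M) = 0"
      unfolding PM by (simp only: inner_scaleR_left inner_scaleR_right inner_add_right[of "u - v"]) simp
  qed simp
  then have "reflect_in (affine hull {E, F, E + (u + v)}) ?P = ?M - (?P - ?M)"
    by (simp add: reflect_in_def scaleR_2)
  also have "\<dots> = E + t *\<^sub>R (F - E) + ((\<alpha> + \<beta>) / 2 - (\<alpha> - \<beta>) / 2) *\<^sub>R u
      + ((\<alpha> + \<beta>) / 2 + (\<alpha> - \<beta>) / 2) *\<^sub>R v"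
    unfolding PM scaleR_add_left scaleR_diff_left by (simp add: algebra_simps)
  finally show ?thesis unfolding halves .
qed

text \<open>Reflection in the bisector plane exchanges the coordinates along the two face directions,
  so isogonality says that \<open>(q\<^sub>R, q\<^sub>S)\<close> is proportional to \<open>(p\<^sub>S, p\<^sub>R)\<close>. On the edgeline both
  coordinates vanish, so the product equation absorbs the vacuous case of the condition.\<close>

lemma isogonal_at_iff_barycentric:
  fixes E F R S P Q :: "real^3"
  assumes ncop: "\<not> coplanar {E, F, R, S}"
    and dist: "dist E R = dist F S" "dist F R = dist E S"
    and p: "pE + pF + pR + pS = 1" "P = pE *\<^sub>R E + pF *\<^sub>R F + pR *\<^sub>R R + pS *\<^sub>R S"
    and q: "qE + qF + qR + qS = 1" "Q = qE *\<^sub>R E + qF *\<^sub>R F + qR *\<^sub>R R + qS *\<^sub>R S"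
  shows "isogonal_at E F R S P Q \<longleftrightarrow> pR * qR = pS * qS"
proof -
  define d where "d = F - E"
  define u where "u = face_direction E F R"
  define v where "v = face_direction E F S"
  obtain h \<rho> \<sigma> where "h > 0"
    and R: "R - E = \<rho> *\<^sub>R d + h *\<^sub>R u" and S: "S - E = \<sigma> *\<^sub>R d + h *\<^sub>R v"
    and unit: "u \<bullet> u = 1" "v \<bullet> v = 1" and orth: "u \<bullet> d = 0" "v \<bullet> d = 0"
    unfolding d_def u_def v_def by (rule face_directions_equal_altitudes[OF ncop dist])
  have indep: "x = 0 \<and> y = 0 \<and> z = 0" if "x *\<^sub>R d + y *\<^sub>R u + z *\<^sub>R v = 0" for x y z
  proof -
    have "(h * x - y * \<rho> - z * \<sigma>) *\<^sub>R d + y *\<^sub>R (R - E) + z *\<^sub>R (S - E)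
        = h *\<^sub>R (x *\<^sub>R d + y *\<^sub>R u + z *\<^sub>R v)"
      unfolding R S by (simp add: algebra_simps)
    also have "\<dots> = 0" using that by simp
    finally have "h * x - y * \<rho> - z * \<sigma> = 0 \<and> y = 0 \<and> z = 0"
      unfolding d_def by (rule edge_vectors_independent[OF ncop])
    with \<open>h > 0\<close> show ?thesis by auto
  qed
  have coord_eq: "E + x *\<^sub>R d + y *\<^sub>R u + z *\<^sub>R v = E + x' *\<^sub>R d + y' *\<^sub>R u + z' *\<^sub>R v
      \<longleftrightarrow> x = x' \<and> y = y' \<and> z = z'" for x y z x' y' z'
    using indep[of "x - x'" "y - y'" "z - z'"] by (auto simp: algebra_simps)
  have coords: "a *\<^sub>R E + b *\<^sub>R F + y *\<^sub>R R + z *\<^sub>R S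
      = E + (b + y * \<rho> + z * \<sigma>) *\<^sub>R d + (h * y) *\<^sub>R u + (h * z) *\<^sub>R v"
    if "a + b + y + z = 1" for a b y z
  proof -
    have "a = 1 - b - y - z" using that by simp
    then have "a *\<^sub>R E + b *\<^sub>R F + y *\<^sub>R R + z *\<^sub>R S = E + b *\<^sub>R d + y *\<^sub>R (R - E) + z *\<^sub>R (S - E)"
      by (simp only:) (simp add: d_def algebra_simps)
    then show ?thesis unfolding R S by (simp add: algebra_simps)
  qed
  obtain tP where P: "P = E + tP *\<^sub>R d + (h * pR) *\<^sub>R u + (h * pS) *\<^sub>R v"
    using coords[OF p(1)] p(2) by blast
  obtain tQ where Q: "Q = E + tQ *\<^sub>R d + (h * qR) *\<^sub>R u + (h * qS) *\<^sub>R v"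
    using coords[OF q(1)] q(2) by blast
  have on_edge: "E + t *\<^sub>R d + (h * y) *\<^sub>R u + (h * z) *\<^sub>R v \<in> edgeline E F \<longleftrightarrow> y = 0 \<and> z = 0" for t y z
  proof -
    have "E + t *\<^sub>R d + (h * y) *\<^sub>R u + (h * z) *\<^sub>R v \<in> edgeline E F \<longleftrightarrow>
        (\<exists>s. E + t *\<^sub>R d + (h * y) *\<^sub>R u + (h * z) *\<^sub>R v = E + s *\<^sub>R d + 0 *\<^sub>R u + 0 *\<^sub>R v)"
      unfolding edgeline_iff d_def by simp
    then show ?thesis unfolding coord_eq using \<open>h > 0\<close> by simp
  qed
  have plane: "Y \<in> affine hull {E, F, P} \<longleftrightarrow>
      (\<exists>s t. Y = E + s *\<^sub>R d + (t * h * pR) *\<^sub>R u + (t * h * pS) *\<^sub>R v)" for Y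
  proof -
    have shift: "E + s *\<^sub>R d + t *\<^sub>R (P - E)
        = E + (s + t * tP) *\<^sub>R d + (t * h * pR) *\<^sub>R u + (t * h * pS) *\<^sub>R v" for s t
      unfolding P by (simp add: algebra_simps)
    have "(\<exists>s. Y = E + (s + t * tP) *\<^sub>R d + (t * h * pR) *\<^sub>R u + (t * h * pS) *\<^sub>R v) \<longleftrightarrow>
        (\<exists>s. Y = E + s *\<^sub>R d + (t * h * pR) *\<^sub>R u + (t * h * pS) *\<^sub>R v)" for t
      by (metis diff_add_cancel)
    then show ?thesis
      unfolding affine_hull_3_point_directions d_def[symmetric] shift by blast
  qed
  have "Q \<in> isogonal_plane E F R S (affine hull {E, F, P}) \<longleftrightarrow>
      (\<exists>s t. Q = reflect_in (bisector_plane E F R S)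
        (E + s *\<^sub>R d + (t * h * pR) *\<^sub>R u + (t * h * pS) *\<^sub>R v))"
    unfolding isogonal_plane_def image_iff Bex_def plane by blast
  also have "\<dots> \<longleftrightarrow> (\<exists>s t. Q = E + s *\<^sub>R d + (t * h * pS) *\<^sub>R u + (t * h * pR) *\<^sub>R v)"
    unfolding bisector_plane_def u_def[symmetric] v_def[symmetric] d_def
    using reflect_in_bisector_swaps[OF unit orth[unfolded d_def]] by simp
  also have "\<dots> \<longleftrightarrow> (\<exists>t. qR = t * pS \<and> qS = t * pR)"
    unfolding Q coord_eq using \<open>h > 0\<close> by (auto simp: ac_simps)
  finally have plane_iff: "Q \<in> isogonal_plane E F R S (affine hull {E, F, P}) \<longleftrightarrow>
      (\<exists>t. qR = t * pS \<and> qS = t * pR)" .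
  have "isogonal_at E F R S P Q \<longleftrightarrow>
      (pR = 0 \<and> pS = 0) \<or> (qR = 0 \<and> qS = 0) \<or> (\<exists>t. qR = t * pS \<and> qS = t * pR)"
    unfolding isogonal_at_def plane_iff unfolding P Q on_edge ..
  also have "\<dots> \<longleftrightarrow> pR * qR = pS * qS"
  proof
    assume eq: "pR * qR = pS * qS"
    show "(pR = 0 \<and> pS = 0) \<or> (qR = 0 \<and> qS = 0) \<or> (\<exists>t. qR = t * pS \<and> qS = t * pR)"
    proof (cases "pR = 0")
      case True
      then show ?thesis using eq by (cases "pS = 0") (auto intro: exI[of _ "qR / pS"])
    next
      case False
      then show ?thesis using eq by (auto intro!: exI[of _ "qS / pR"] simp: field_simps)
    qed
  qed auto
  finally show ?thesis .
qed

section \<open>The circumsphere in barycentric coordinates\<close>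

text \<open>The arguments \<open>l\<close>, \<open>m\<close>, \<open>n\<close> stand for the squared edge lengths \<open>AB\<^sup>2 = CD\<^sup>2\<close>,
  \<open>BC\<^sup>2 = AD\<^sup>2\<close>, \<open>AC\<^sup>2 = BD\<^sup>2\<close>.\<close>

definition opposite_edges_form :: "real \<Rightarrow> real \<Rightarrow> real \<Rightarrow> real \<Rightarrow> real \<Rightarrow> real \<Rightarrow> real \<Rightarrow> real" where
  "opposite_edges_form l m n x y z w = l * (x * y + z * w) + m * (y * z + x * w) + n * (x * z + y * w)"

text \<open>With the circumcentre as origin, expand the square and polarise: for vectors of length \<open>r\<close>,
  the inner product is \<open>r\<^sup>2\<close> minus half the squared distance.\<close>

lemma norm_barycentric_circumcentre:
  fixes a b c d :: "'a::real_inner"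
  assumes "norm a = r" "norm b = r" "norm c = r" "norm d = r"
    and "dist a b = dist c d" "dist b c = dist a d" "dist a c = dist b d"
  shows "(norm (x *\<^sub>R a + y *\<^sub>R b + z *\<^sub>R c + w *\<^sub>R d))\<^sup>2
    = r\<^sup>2 * (x + y + z + w)\<^sup>2
      - opposite_edges_form ((dist a b)\<^sup>2) ((dist b c)\<^sup>2) ((dist a c)\<^sup>2) x y z w"
proof -
  have polar: "p \<bullet> q = r\<^sup>2 - (dist p q)\<^sup>2 / 2" if "norm p = r" "norm q = r" for p q :: 'a
    using that by (simp add: dist_norm dot_norm_neg field_simps)
  have sq: "p \<bullet> p = r\<^sup>2" if "norm p = r" for p :: 'a
    using that by (simp add: power2_norm_eq_inner[symmetric])
  have "(norm (x *\<^sub>R a + y *\<^sub>R b + z *\<^sub>R c + w *\<^sub>R d))\<^sup>2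
      = x\<^sup>2 * (a \<bullet> a) + y\<^sup>2 * (b \<bullet> b) + z\<^sup>2 * (c \<bullet> c) + w\<^sup>2 * (d \<bullet> d)
      + 2 * (x * y * (a \<bullet> b) + x * z * (a \<bullet> c) + x * w * (a \<bullet> d)
      + y * z * (b \<bullet> c) + y * w * (b \<bullet> d) + z * w * (c \<bullet> d))"
    unfolding power2_norm_eq_inner
    by (simp add: inner_simps inner_commute power2_eq_square algebra_simps)
  also have "\<dots> = r\<^sup>2 * (x + y + z + w)\<^sup>2
      - opposite_edges_form ((dist a b)\<^sup>2) ((dist b c)\<^sup>2) ((dist a c)\<^sup>2) x y z w"
    unfolding sq[OF assms(1)] sq[OF assms(2)] sq[OF assms(3)] sq[OF assms(4)]
      polar[OF assms(1,2)] polar[OF assms(1,3)] polar[OF assms(1,4)]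
      polar[OF assms(2,3)] polar[OF assms(2,4)] polar[OF assms(3,4)]
      assms(5)[symmetric] assms(6)[symmetric] assms(7)[symmetric] opposite_edges_form_def
    by (simp add: power2_eq_square field_simps)
  finally show ?thesis .
qed

section \<open>Inversion of coordinates\<close>

definition equal_products :: "real \<Rightarrow> real \<Rightarrow> real \<Rightarrow> real \<Rightarrow> real \<Rightarrow> real \<Rightarrow> real \<Rightarrow> real \<Rightarrow> bool" where
  "equal_products x y z w x' y' z' w' \<longleftrightarrow> x * x' = y * y' \<and> y * y' = z * z' \<and> z * z' = w * w'"

lemma opposite_edges_form_inverse:
  assumes "x \<noteq> 0" "y \<noteq> 0" "z \<noteq> 0" "w \<noteq> 0"
  shows "opposite_edges_form l m n (k / x) (k / y) (k / z) (k / w)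
    = k\<^sup>2 / (x * y * z * w) * opposite_edges_form l m n x y z w"
  using assms by (simp add: opposite_edges_form_def field_simps power2_eq_square)

text \<open>A zero of the form on a face plane is either a vertex or has only one vanishing coordinate;
  in the latter case the common product is \<open>0\<close>, which forces the opposite vertex.\<close>

lemma equal_products_face:
  assumes pos: "l > 0" "m > 0" "n > 0"
    and "x = 0" "x + y + z + w = 1" "opposite_edges_form l m n x y z w = 0"
    and "y \<noteq> 1 \<or> z \<noteq> 0 \<or> w \<noteq> 0" "y \<noteq> 0 \<or> z \<noteq> 1 \<or> w \<noteq> 0" "y \<noteq> 0 \<or> z \<noteq> 0 \<or> w \<noteq> 1"
    and "x' + y' + z' + w' = 1"
  shows "equal_products x y z w x' y' z' w' \<longleftrightarrow> x' = 1 \<and> y' = 0 \<and> z' = 0 \<and> w' = 0"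
proof -
  have form: "l * (z * w) + m * (y * z) + n * (y * w) = 0"
    using assms(4,6) by (simp add: opposite_edges_form_def)
  then have "y \<noteq> 0" "z \<noteq> 0" "w \<noteq> 0" using assms by auto
  then show ?thesis using assms(4,10) by (auto simp: equal_products_def)
qed

text \<open>The definiteness assumption is the algebraic trace of the geometry: on coordinates with sum
  \<open>0\<close> the form is minus the squared length of the represented vector. It prevents the inverses
  from adding up to \<open>0\<close>, so they can be normalised.\<close>

lemma equal_products_unique_solution:
  assumes pos: "l > 0" "m > 0" "n > 0"
    and sum: "x + y + z + w = 1" and form: "opposite_edges_form l m n x y z w = 0"
    and novertex: "x \<noteq> 1 \<or> y \<noteq> 0 \<or> z \<noteq> 0 \<or> w \<noteq> 0" "x \<noteq> 0 \<or> y \<noteq> 1 \<or> z \<noteq> 0 \<or> w \<noteq> 0"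
      "x \<noteq> 0 \<or> y \<noteq> 0 \<or> z \<noteq> 1 \<or> w \<noteq> 0" "x \<noteq> 0 \<or> y \<noteq> 0 \<or> z \<noteq> 0 \<or> w \<noteq> 1"
    and definite: "\<And>x y z w. x + y + z + w = 0 \<Longrightarrow> opposite_edges_form l m n x y z w = 0 \<Longrightarrow> x = 0"
  obtains a b c d where "a + b + c + d = 1" "opposite_edges_form l m n a b c d = 0"
    and "\<And>x' y' z' w'. x' + y' + z' + w' = 1 \<Longrightarrow>
      equal_products x y z w x' y' z' w' \<longleftrightarrow> x' = a \<and> y' = b \<and> z' = c \<and> w' = d"
proof (cases "x = 0 \<or> y = 0 \<or> z = 0 \<or> w = 0")
  case True
  note form' = form[unfolded opposite_edges_form_def]
  \<comment> \<open>The form is invariant under the double transpositions of the coordinates, which act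
    transitively, so every face reduces to the first one.\<close>
  from True consider "x = 0" | "y = 0" | "z = 0" | "w = 0" by blast
  then show thesis
  proof cases
    case 1
    note face = equal_products_face[of l m n x y z w]
    show thesis
    proof (rule that[of 1 0 0 0])
      show "equal_products x y z w x' y' z' w' \<longleftrightarrow> x' = 1 \<and> y' = 0 \<and> z' = 0 \<and> w' = 0"
        if "x' + y' + z' + w' = 1" for x' y' z' w'
        using face[of x' y' z' w'] pos sum form novertex 1 that by simp
    qed (simp_all add: opposite_edges_form_def)
  next
    case 2
    have form2: "opposite_edges_form l m n y x w z = 0"
      using form' by (simp add: opposite_edges_form_def algebra_simps)
    note face = equal_products_face[of l m n y x w z]
    show thesis
    proof (rule that[of 0 1 0 0])
      show "equal_products x y z w x' y' z' w' \<longleftrightarrow> x' = 0 \<and> y' = 1 \<and> z' = 0 \<and> w' = 0"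
        if "x' + y' + z' + w' = 1" for x' y' z' w'
      proof -
        have "equal_products x y z w x' y' z' w' \<longleftrightarrow> equal_products y x w z y' x' w' z'"
          by (auto simp: equal_products_def)
        also have "\<dots> \<longleftrightarrow> y' = 1 \<and> x' = 0 \<and> w' = 0 \<and> z' = 0"
          by (rule face) (use pos sum form2 novertex 2 that in \<open>(linarith | blast)+\<close>)
        finally show ?thesis by blast
      qed
    qed (simp_all add: opposite_edges_form_def)
  next
    case 3
    have form3: "opposite_edges_form l m n z w x y = 0"
      using form' by (simp add: opposite_edges_form_def algebra_simps)
    note face = equal_products_face[of l m n z w x y]
    show thesis
    proof (rule that[of 0 0 1 0])
      show "equal_products x y z w x' y' z' w' \<longleftrightarrow> x' = 0 \<and> y' = 0 \<and> z' = 1 \<and> w' = 0"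
        if "x' + y' + z' + w' = 1" for x' y' z' w'
      proof -
        have "equal_products x y z w x' y' z' w' \<longleftrightarrow> equal_products z w x y z' w' x' y'"
          by (auto simp: equal_products_def)
        also have "\<dots> \<longleftrightarrow> z' = 1 \<and> w' = 0 \<and> x' = 0 \<and> y' = 0"
          by (rule face) (use pos sum form3 novertex 3 that in \<open>(linarith | blast)+\<close>)
        finally show ?thesis by blast
      qed
    qed (simp_all add: opposite_edges_form_def)
  next
    case 4
    have form4: "opposite_edges_form l m n w z y x = 0"
      using form' by (simp add: opposite_edges_form_def algebra_simps)
    note face = equal_products_face[of l m n w z y x]
    show thesis
    proof (rule that[of 0 0 0 1])
      show "equal_products x y z w x' y' z' w' \<longleftrightarrow> x' = 0 \<and> y' = 0 \<and> z' = 0 \<and> w' = 1"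
        if "x' + y' + z' + w' = 1" for x' y' z' w'
      proof -
        have "equal_products x y z w x' y' z' w' \<longleftrightarrow> equal_products w z y x w' z' y' x'"
          by (auto simp: equal_products_def)
        also have "\<dots> \<longleftrightarrow> w' = 1 \<and> z' = 0 \<and> y' = 0 \<and> x' = 0"
          by (rule face) (use pos sum form4 novertex 4 that in \<open>(linarith | blast)+\<close>)
        finally show ?thesis by blast
      qed
    qed (simp_all add: opposite_edges_form_def)
  qed
next
  case False
  then have nz: "x \<noteq> 0" "y \<noteq> 0" "z \<noteq> 0" "w \<noteq> 0" by auto
  define s where "s = 1 / x + 1 / y + 1 / z + 1 / w"
  have inverse_form: "opposite_edges_form l m n (k / x) (k / y) (k / z) (k / w) = 0" for k
    using opposite_edges_form_inverse[OF nz] form by simp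
  have "s \<noteq> 0"
    using definite[of "1 / x" "1 / y" "1 / z" "1 / w"] inverse_form[of 1] nz(1) by (auto simp: s_def)
  define k where "k = 1 / s"
  have total: "t / x + t / y + t / z + t / w = t * s" for t
    by (simp add: s_def distrib_left)
  show thesis
  proof
    show "k / x + k / y + k / z + k / w = 1"
      using total[of k] \<open>s \<noteq> 0\<close> by (simp add: k_def)
    show "opposite_edges_form l m n (k / x) (k / y) (k / z) (k / w) = 0" by (rule inverse_form)
    show "equal_products x y z w x' y' z' w' \<longleftrightarrow> x' = k / x \<and> y' = k / y \<and> z' = k / z \<and> w' = k / w"
      if sum': "x' + y' + z' + w' = 1" for x' y' z' w'
    proof
      assume "equal_products x y z w x' y' z' w'"
      then have "x' = (x * x') / x" "y' = (x * x') / y" "z' = (x * x') / z" "w' = (x * x') / w"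
        using nz unfolding equal_products_def by (metis nonzero_mult_div_cancel_left)+
      moreover from this have "(x * x') * s = 1" using total[of "x * x'"] sum' by metis
      then have "x * x' = k" using \<open>s \<noteq> 0\<close> by (simp add: k_def field_simps)
      ultimately show "x' = k / x \<and> y' = k / y \<and> z' = k / z \<and> w' = k / w" by metis
    qed (use nz in \<open>simp add: equal_products_def\<close>)
  qed
qed

section \<open>The conjugate of a point on the circumsphere\<close>

lemma isogonal_conjugate_iff_equal_products:
  assumes "isosceles_tetrahedron A B C D"
    and p: "x + y + z + w = 1" "P = x *\<^sub>R A + y *\<^sub>R B + z *\<^sub>R C + w *\<^sub>R D"
    and q: "x' + y' + z' + w' = 1" "Q = x' *\<^sub>R A + y' *\<^sub>R B + z' *\<^sub>R C + w' *\<^sub>R D"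
  shows "isogonal_conjugate A B C D P Q \<longleftrightarrow> equal_products x y z w x' y' z' w'"
proof -
  have ncop: "\<not> coplanar {A, B, C, D}"
    and dist: "dist A B = dist C D" "dist B C = dist A D" "dist A C = dist B D"
    using assms(1) by (simp_all add: isosceles_tetrahedron_def)
  note edge = isogonal_at_iff_barycentric[where P = P and Q = Q]
  have "isogonal_at A B C D P Q \<longleftrightarrow> z * z' = w * w'"
    by (rule edge[of _ _ _ _ x y _ _ x' y'])
      (use ncop dist p q in \<open>simp_all add: dist_commute insert_commute\<close>)
  moreover have "isogonal_at A C B D P Q \<longleftrightarrow> y * y' = w * w'"
    by (rule edge[of _ _ _ _ x z _ _ x' z'])
      (use ncop dist p q in \<open>simp_all add: dist_commute insert_commute\<close>)
  moreover have "isogonal_at A D B C P Q \<longleftrightarrow> y * y' = z * z'"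
    by (rule edge[of _ _ _ _ x w _ _ x' w'])
      (use ncop dist p q in \<open>simp_all add: dist_commute insert_commute\<close>)
  moreover have "isogonal_at B C A D P Q \<longleftrightarrow> x * x' = w * w'"
    by (rule edge[of _ _ _ _ y z _ _ y' z'])
      (use ncop dist p q in \<open>simp_all add: dist_commute insert_commute\<close>)
  moreover have "isogonal_at B D A C P Q \<longleftrightarrow> x * x' = z * z'"
    by (rule edge[of _ _ _ _ y w _ _ y' w'])
      (use ncop dist p q in \<open>simp_all add: dist_commute insert_commute\<close>)
  moreover have "isogonal_at C D A B P Q \<longleftrightarrow> x * x' = y * y'"
    by (rule edge[of _ _ _ _ z w _ _ z' w'])
      (use ncop dist p q in \<open>simp_all add: dist_commute insert_commute\<close>)
  ultimately show ?thesis
    unfolding isogonal_conjugate_def equal_products_def by auto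
qed

theorem theorem6p1:
  fixes A B C D X :: "real^3" and \<Omega> :: "(real^3) set"
  assumes "isosceles_tetrahedron A B C D"
    and "is_circumsphere \<Omega> A B C D"
    and "X \<in> \<Omega>"
    and "X \<notin> {A, B, C, D}"
  shows "(\<exists>!Q. isogonal_conjugate A B C D X Q) \<and>
         (\<forall>Q. isogonal_conjugate A B C D X Q \<longrightarrow> Q \<in> \<Omega>)"
proof -
  have ncop: "\<not> coplanar {A, B, C, D}"
    and dist: "dist A B = dist C D" "dist B C = dist A D" "dist A C = dist B D"
    using assms(1) by (simp_all add: isosceles_tetrahedron_def)
  have "A \<noteq> B" "B \<noteq> C" "A \<noteq> C"
    using affine_independent_if_not_coplanar(2)[OF ncop]
    by (auto simp: card_insert_if split: if_splits)
  define l m n where "l = (dist A B)\<^sup>2" and "m = (dist B C)\<^sup>2" and "n = (dist A C)\<^sup>2"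
  have pos: "l > 0" "m > 0" "n > 0"
    using \<open>A \<noteq> B\<close> \<open>B \<noteq> C\<close> \<open>A \<noteq> C\<close> by (simp_all add: l_def m_def n_def)
  obtain ctr r where \<Omega>: "\<Omega> = sphere ctr r" and "{A, B, C, D} \<subseteq> \<Omega>"
    using assms(2) unfolding is_circumsphere_def by blast
  then have norms: "norm (A - ctr) = r" "norm (B - ctr) = r" "norm (C - ctr) = r" "norm (D - ctr) = r"
    by (auto simp: dist_norm norm_minus_commute)
  have "r \<ge> 0" using norms(1) by auto
  have translate: "dist (P - ctr) (Q - ctr) = dist P Q" for P Q by (simp add: dist_norm)
  have norm_comb: "(norm (x *\<^sub>R (A - ctr) + y *\<^sub>R (B - ctr) + z *\<^sub>R (C - ctr) + w *\<^sub>R (D - ctr)))\<^sup>2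
      = r\<^sup>2 * (x + y + z + w)\<^sup>2 - opposite_edges_form l m n x y z w" for x y z w
    using norm_barycentric_circumcentre[OF norms] dist unfolding translate l_def m_def n_def by blast
  have on_sphere: "x *\<^sub>R A + y *\<^sub>R B + z *\<^sub>R C + w *\<^sub>R D \<in> \<Omega> \<longleftrightarrow> opposite_edges_form l m n x y z w = 0"
    if "x + y + z + w = 1" for x y z w
  proof -
    let ?P = "x *\<^sub>R A + y *\<^sub>R B + z *\<^sub>R C + w *\<^sub>R D"
    have "?P - (x + y + z + w) *\<^sub>R ctr
        = x *\<^sub>R (A - ctr) + y *\<^sub>R (B - ctr) + z *\<^sub>R (C - ctr) + w *\<^sub>R (D - ctr)"
      by (simp add: algebra_simps)
    then have "(norm (?P - ctr))\<^sup>2 = r\<^sup>2 - opposite_edges_form l m n x y z w"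
      using norm_comb[of x y z w] that by simp
    moreover have "?P \<in> \<Omega> \<longleftrightarrow> (norm (?P - ctr))\<^sup>2 = r\<^sup>2"
      using \<open>r \<ge> 0\<close> by (simp add: \<Omega> dist_norm norm_minus_commute)
    ultimately show ?thesis by simp
  qed
  have definite: "x = 0" if "x + y + z + w = 0" "opposite_edges_form l m n x y z w = 0" for x y z w
  proof -
    have "x *\<^sub>R (A - ctr) + y *\<^sub>R (B - ctr) + z *\<^sub>R (C - ctr) + w *\<^sub>R (D - ctr) = 0"
      using norm_comb[of x y z w] that by simp
    moreover have "x = - y - z - w" using that(1) by simp
    ultimately have "y *\<^sub>R (B - A) + z *\<^sub>R (C - A) + w *\<^sub>R (D - A) = 0"
      by (simp add: algebra_simps)
    then have "y = 0 \<and> z = 0 \<and> w = 0" by (rule edge_vectors_independent[OF ncop])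
    then show "x = 0" using that(1) by simp
  qed
  obtain x y z w where X: "x + y + z + w = 1" "X = x *\<^sub>R A + y *\<^sub>R B + z *\<^sub>R C + w *\<^sub>R D"
    by (rule barycentric_coordinates_exist[OF ncop])
  have form: "opposite_edges_form l m n x y z w = 0"
    using on_sphere[OF X(1)] X(2) assms(3) by simp
  have novertex: "x \<noteq> 1 \<or> y \<noteq> 0 \<or> z \<noteq> 0 \<or> w \<noteq> 0" "x \<noteq> 0 \<or> y \<noteq> 1 \<or> z \<noteq> 0 \<or> w \<noteq> 0"
      "x \<noteq> 0 \<or> y \<noteq> 0 \<or> z \<noteq> 1 \<or> w \<noteq> 0" "x \<noteq> 0 \<or> y \<noteq> 0 \<or> z \<noteq> 0 \<or> w \<noteq> 1"
    using assms(4) X(2) by auto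
  obtain a b c d where sol: "a + b + c + d = 1" "opposite_edges_form l m n a b c d = 0"
    and unique: "\<And>x' y' z' w'. x' + y' + z' + w' = 1 \<Longrightarrow>
      equal_products x y z w x' y' z' w' \<longleftrightarrow> x' = a \<and> y' = b \<and> z' = c \<and> w' = d"
  proof (rule equal_products_unique_solution[OF pos X(1) form novertex])
    show "x = 0" if "x + y + z + w = 0" "opposite_edges_form l m n x y z w = 0" for x y z w
      using that by (rule definite)
  qed (rule that)
  let ?Q = "a *\<^sub>R A + b *\<^sub>R B + c *\<^sub>R C + d *\<^sub>R D"
  have "isogonal_conjugate A B C D X Q \<longleftrightarrow> Q = ?Q" for Q
  proof
    assume conj: "isogonal_conjugate A B C D X Q"
    obtain x' y' z' w' where Q: "x' + y' + z' + w' = 1"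
        "Q = x' *\<^sub>R A + y' *\<^sub>R B + z' *\<^sub>R C + w' *\<^sub>R D"
      by (rule barycentric_coordinates_exist[OF ncop])
    have "equal_products x y z w x' y' z' w'"
      using isogonal_conjugate_iff_equal_products[OF assms(1) X Q] conj by blast
    then show "Q = ?Q" using unique[OF Q(1)] Q(2) by blast
  next
    assume "Q = ?Q"
    then show "isogonal_conjugate A B C D X Q"
      using isogonal_conjugate_iff_equal_products[OF assms(1) X sol(1)] unique[OF sol(1)] by blast
  qed
  moreover have "?Q \<in> \<Omega>" using on_sphere[OF sol(1)] sol(2) by blast
  ultimately show ?thesis by simp
qed

end
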